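(* In the setting described in the context, if the Slater condition holds, i.e. there exists $u\in\mathbb{R}^m$ such that $p(u,y)<0$ for all $y\in\mathbf{Y}$ and $\psi_j(u)<0$ for all $j=1,\dots,s$, then $\mathcal{C}_1+\mathcal{C}_2$ is closed.
   Context: Let $\mathbf{Y}\subset\mathbb{R}^n$ be compact. Let $\psi_1,\dots,\psi_s:\mathbb{R}^m\to\mathbb{R}$, and $p(\cdot,y):\mathbb{R}^m\to\mathbb{R}$ for every $y\in\mathbf{Y}$, be continuous convex functions (not necessarily polynomials), where $p:\mathbb{R}^m\times\mathbb{R}^n\to\mathbb{R}$ is lower semicontinuous and $p(x,\cdot):\mathbb{R}^n\to\mathbb{R}$ is continuous for all $x\in\mathbb{R}^m$. Assume $\mathbf{K}:=\{x\in\mathbb{R}^m:\psi_1(x)\le 0,\dots,\psi_s(x)\le 0,\ p(x,y)\le 0\ \forall y\in\mathbf{Y}\}\neq\emptyset$. $\mathcal{M}(\mathbf{Y})$ denotes the set of (finite) nonnegative Borel measures supported on $\mathbf{Y}$. For a function $\varphi$ on $\mathbb{R}^m$, $\varphi^*(\xi)=\sup_{x\in\mathbb{R}^m}\{\langle\xi,x\rangle-\varphi(x)\}$ is its conjugate and $\operatorname{epi}\varphi^*\subset\mathbb{R}^{m+1}$ the epigraph of $\varphi^*$. Set $$\mathcal{C}_1:=\bigcup_{\mu\in\mathcal{M}(\mathbf{Y})}\operatorname{epi}\Big(\int_{\mathbf{Y}}p(\cdot,y)\,d\mu(y)\Big)^*,\qquad \mathcal{C}_2:=\bigcup_{\eta\in\mathbb{R}_+^s}\operatorname{epi}\Big(\sum_{j=1}^s\eta_j\psi_j\Big)^*.$$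 *)

theory Defs
  imports "HOL-Analysis.Analysis" "HOL-Library.Set_Algebras"
begin

definition lower_semicont :: "('a::topological_space \<Rightarrow> real) \<Rightarrow> bool" where
  "lower_semicont f \<longleftrightarrow> (\<forall>z. \<forall>a < f z. \<forall>\<^sub>F w in nhds z. a < f w)"

(* Finite Borel measures on the whole space that vanish off Y.  For closed Y this is the same
   as saying that the topological support is contained in Y. *)
definition finite_measures_on :: "'a::topological_space set \<Rightarrow> 'a measure set" where
  "finite_measures_on Y =
     {\<mu>. sets \<mu> = sets borel \<and> finite_measure \<mu> \<and> emeasure \<mu> (UNIV - Y) = 0}"

(* Extended-real valued, since the supremum may be infinite. *)
definition conjugate :: "('a::real_inner \<Rightarrow> real) \<Rightarrow> 'a \<Rightarrow> ereal" where
  "conjugate \<phi> \<xi> = (SUP x. ereal (\<xi> \<bullet> x - \<phi> x))"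

(* The library's epigraph is only for real-valued functions. *)
definition epi :: "('a \<Rightarrow> ereal) \<Rightarrow> ('a \<times> real) set" where
  "epi g = {(\<xi>, r). g \<xi> \<le> ereal r}"

definition C1 :: "('b::euclidean_space) set \<Rightarrow> ('a::euclidean_space \<Rightarrow> 'b \<Rightarrow> real) \<Rightarrow> ('a \<times> real) set"
  where "C1 Y p = (\<Union>\<mu>\<in>finite_measures_on Y. epi (conjugate (\<lambda>x. LINT y:Y|\<mu>. p x y)))"

definition C2 :: "nat \<Rightarrow> (nat \<Rightarrow> 'a::euclidean_space \<Rightarrow> real) \<Rightarrow> ('a \<times> real) set"
  where "C2 s \<psi> =
    (\<Union>\<eta>\<in>{\<eta>. \<forall>j\<in>{1..s}. (0::real) \<le> \<eta> j}. epi (conjugate (\<lambda>x. \<Sum>j=1..s. \<eta> j * \<psi> j x)))"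

end

theory Submission
  imports Defs
begin

text \<open>The set \<open>C1 + C2\<close> turns out to be the polar description
  \<open>{(\<xi>, r). \<forall>x\<in>K. \<xi> \<bullet> x \<le> r}\<close> of the feasible set \<open>K\<close>, which is an intersection of closed
  half-spaces. The non-trivial inclusion is a Farkas lemma. Normalise the epigraphs of the conjugates
  of the individual constraints by the functional \<open>(a, \<alpha>) \<mapsto> \<alpha> - a \<bullet> u\<close>, which is
  positive there by the Slater condition. The normalised elements, together with the limit
  direction \<open>(0, 1)\<close>, form a compact set \<open>B\<close> avoiding the origin, so the convex cone generated by
  \<open>B\<close> is closed. It lies in \<open>C1 + C2\<close>, finitely supported measures being enough for this, and a
  point outside it is separated from it by some \<open>x \<in> K\<close>.\<close>

text \<open>Here \<open>t\<close> is the factor coming from the normalisation \<open>\<alpha> - a \<bullet> u = 1\<close>; the value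
  \<open>t = 0\<close> accounts for the direction \<open>(0, 1)\<close>, which arises as a limit.\<close>
definition normalized_epi ::
    "'a::euclidean_space \<Rightarrow> 'z set \<Rightarrow> ('a \<Rightarrow> 'z \<Rightarrow> real) \<Rightarrow> ('a \<times> real) set" where
  "normalized_epi u Z F =
     {(a, \<alpha>). \<alpha> - a \<bullet> u = 1 \<and> (\<exists>z\<in>Z. \<exists>t\<ge>0. \<forall>x. a \<bullet> x - t * F x z \<le> \<alpha>)}"

lemma epi_conjugate_iff:
  "(a, \<alpha>) \<in> epi (conjugate f) \<longleftrightarrow> (\<forall>x. a \<bullet> x - f x \<le> \<alpha>)"
  by (auto simp: epi_def conjugate_def SUP_le_iff)

section \<open>Compactness of the normalised epigraphs\<close>

lemma bounded_continuous_image_abs: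
  fixes g :: "'z::topological_space \<Rightarrow> real"
  assumes "compact Z" "continuous_on Z g"
  obtains M where "M \<ge> 0" "\<And>z. z \<in> Z \<Longrightarrow> \<bar>g z\<bar> \<le> M"
proof -
  have "bounded (g ` Z)"
    using assms compact_continuous_image compact_imp_bounded by blast
  then obtain M where "M > 0" "\<And>z. z \<in> Z \<Longrightarrow> \<bar>g z\<bar> \<le> M"
    by (auto simp: bounded_pos)
  then show ?thesis
    using that[of M] by auto
qed

text \<open>Testing the defining inequality at finitely many points bounds all parameters:
  \<open>x = u\<close> bounds \<open>t\<close>, the points \<open>u + b\<close> and
  \<open>u - b\<close> with \<open>b\<close> a basis vector bound \<open>a\<close>, and the
  normalisation then bounds \<alpha>. The set is thus a projection of a compact set of tuples
  \<open>((a, \<alpha>), (t, z))\<close>.\<close>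

lemma compact_normalized_epi:
  fixes F :: "'a::euclidean_space \<Rightarrow> 'z::t2_space \<Rightarrow> real"
  assumes Z: "compact Z" and cont: "\<And>x. continuous_on Z (F x)"
    and neg: "\<And>z. z \<in> Z \<Longrightarrow> F u z < 0"
  shows "compact (normalized_epi u Z F)"
proof (cases "Z = {}")
  case True
  then show ?thesis by (simp add: normalized_epi_def)
next
  case False
  obtain z0 where z0: "z0 \<in> Z" "\<And>z. z \<in> Z \<Longrightarrow> F u z \<le> F u z0"
    using continuous_attains_sup[OF Z False cont] by blast
  \<comment> \<open>At \<open>x = u\<close> the inequality and the normalisation give
    \<open>- t * F u z \<le> 1\<close>; the weakest resulting bound on \<open>t\<close> occurs at
    the maximiser \<open>z0\<close>.\<close>
  define T where "T = - 1 / F u z0"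
  have d: "F u z0 < 0" using neg z0 by blast
  have T0: "T \<ge> 0" using d by (simp add: T_def divide_simps)
  have tT: "t \<le> T" if "z \<in> Z" "t \<ge> 0" "- t * F u z \<le> 1" for t z
  proof -
    have "t * (- F u z0) \<le> t * (- F u z)"
      using z0 that by (intro mult_left_mono) auto
    then have "t * (- F u z0) \<le> 1" using that by simp
    then show ?thesis using d by (simp add: T_def field_simps)
  qed
  have "\<exists>M\<ge>0. \<forall>z\<in>Z. \<bar>F x z\<bar> \<le> M" for x
    using bounded_continuous_image_abs[OF Z cont[of x]] by metis
  then obtain M where M: "\<And>x. M x \<ge> 0" "\<And>x z. z \<in> Z \<Longrightarrow> \<bar>F x z\<bar> \<le> M x"
    by metis
  define R where "R = (\<Sum>b\<in>Basis. 1 + T * (M (u + b) + M (u - b)))"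
  define \<Omega> where "\<Omega> = (cball (0::'a) R \<times> {- (1 + R * norm u)..1 + R * norm u}) \<times> ({0..T} \<times> Z)"
  \<comment> \<open>For each fixed \<open>x\<close> the condition is closed in
    \<open>(a, \<alpha>, t, z)\<close> by continuity of \<open>F x\<close> in \<open>z\<close>
    alone; joint continuity never enters.\<close>
  define G where "G = {w \<in> \<Omega>. snd (fst w) - fst (fst w) \<bullet> u = 1}
    \<inter> (\<Inter>x. {w \<in> \<Omega>. fst (fst w) \<bullet> x - fst (snd w) * F x (snd (snd w)) \<le> snd (fst w)})"
  have cO: "compact \<Omega>"
    unfolding \<Omega>_def by (intro compact_Times Z compact_cball compact_Icc)
  then have clO: "closed \<Omega>" by (rule compact_imp_closed)
  have cF: "continuous_on \<Omega> (\<lambda>w. F x (snd (snd w)))" for x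
    by (rule continuous_on_compose2[OF cont[of x]])
       (auto simp: \<Omega>_def intro!: continuous_intros)
  have "closed G"
    unfolding G_def
    by (intro closed_Int closed_INT ballI continuous_on_closed_Collect_le clO
        continuous_closed_preimage_constant continuous_intros cF)
  moreover have "G = G \<inter> \<Omega>" by (auto simp: G_def)
  ultimately have "compact G"
    using cO by (metis closed_Int_compact)
  then have "compact (fst ` G)"
    by (intro compact_continuous_image continuous_intros)
  moreover have "fst ` G = normalized_epi u Z F"
  proof
    show "fst ` G \<subseteq> normalized_epi u Z F"
      by (fastforce simp: G_def \<Omega>_def normalized_epi_def)
    show "normalized_epi u Z F \<subseteq> fst ` G"
    proof safe
      fix a \<alpha> assume "(a, \<alpha>) \<in> normalized_epi u Z F"
      then obtain z t where L: "\<alpha> - a \<bullet> u = 1" and z: "z \<in> Z" and t: "t \<ge> 0"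
        and le: "\<And>x. a \<bullet> x - t * F x z \<le> \<alpha>"
        by (auto simp: normalized_epi_def)
      have t2: "t \<le> T" using tT[OF z t] le[of u] L by simp
      have bnd: "a \<bullet> h \<le> 1 + T * M (u + h)" for h
      proof -
        have "t * F (u + h) z \<le> t * M (u + h)"
          using M(2)[OF z, of "u + h"] t by (intro mult_left_mono) auto
        also have "\<dots> \<le> T * M (u + h)" using t2 M(1) by (intro mult_right_mono) auto
        finally show ?thesis using le[of "u + h"] L by (simp add: inner_add_right)
      qed
      have "\<bar>a \<bullet> b\<bar> \<le> 1 + T * (M (u + b) + M (u - b))" for b
      proof -
        have "T * M (u + b) \<ge> 0" "T * M (u - b) \<ge> 0" using M T0 by auto
        then show ?thesis using bnd[of b] bnd[of "- b"] by (auto simp: distrib_left)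
      qed
      then have aR: "norm a \<le> R"
        unfolding R_def by (intro order.trans[OF norm_le_l1] sum_mono)
      have "\<bar>a \<bullet> u\<bar> \<le> R * norm u"
        using Cauchy_Schwarz_ineq2[of a u] aR
        by (meson mult_right_mono norm_ge_zero order_trans)
      then have "((a, \<alpha>), (t, z)) \<in> G"
        using aR L le t t2 z by (auto simp: G_def \<Omega>_def)
      then show "(a, \<alpha>) \<in> fst ` G" by force
    qed
  qed
  ultimately show ?thesis by simp
qed

section \<open>Separation, and the way back from polar elements to feasible points\<close>

text \<open>A hyperplane separating \<open>(x0, c)\<close> from the closed epigraph cannot be
  vertical, because \<open>(x0, f x0)\<close> lies directly above that point. Dividing by the
  positive last coefficient \<open>k\<close> of its normal turns it into an affine function.\<close>

lemma convex_strict_affine_minorant: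
  fixes f :: "'a::euclidean_space \<Rightarrow> real"
  assumes "convex_on UNIV f" "continuous_on UNIV f" "c < f x0"
  obtains a \<alpha> where "\<And>x. a \<bullet> x - f x \<le> \<alpha>" "a \<bullet> x0 - \<alpha> > c"
proof -
  have eq: "epigraph UNIV f = {w. f (fst w) \<le> snd w}"
    by (auto simp: epigraph_def)
  have "closed (epigraph UNIV f)"
    unfolding eq
    by (intro closed_Collect_le continuous_on_compose2[OF assms(2)] continuous_intros) auto
  moreover have "convex (epigraph UNIV f)"
    using assms(1) by (rule convex_epigraphI)
  moreover have "(x0, c) \<notin> epigraph UNIV f"
    using assms(3) by (simp add: mem_epigraph)
  ultimately obtain w \<beta> where w: "w \<bullet> (x0, c) < \<beta>" "\<And>e. e \<in> epigraph UNIV f \<Longrightarrow> w \<bullet> e > \<beta>"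
    using separating_hyperplane_closed_point by metis
  obtain v k where wv: "w = (v, k)" by (cases w)
  have w1: "v \<bullet> x0 + k * c < \<beta>" using w(1) wv by simp
  have w2: "v \<bullet> x + k * f x > \<beta>" for x
    using w(2)[of "(x, f x)"] wv by (simp add: mem_epigraph)
  have "k * c < k * f x0" using w1 w2[of x0] by linarith
  then have k: "k > 0" using assms(3)
    by (metis less_eq_real_def mult_less_cancel_left not_less_iff_gr_or_eq)
  show thesis
  proof (rule that)
    show "(- (1 / k) *\<^sub>R v) \<bullet> x - f x \<le> - \<beta> / k" for x
    proof -
      have "\<beta> / k \<le> (v \<bullet> x + k * f x) / k"
        using w2[of x] k by (intro divide_right_mono) auto
      then show ?thesis using k by (simp add: add_divide_distrib)
    qed
    show "(- (1 / k) *\<^sub>R v) \<bullet> x0 - (- \<beta> / k) > c"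
      using w1 k by (simp add: field_simps)
  qed
qed

text \<open>Elements of the polar of the cone generated by \<open>normalized_epi\<close> that have the form
  \<open>(- x, 1)\<close> come from feasible points \<open>x\<close>.\<close>
lemma nonpos_if_polar_normalized_epi:
  fixes F :: "'a::euclidean_space \<Rightarrow> 'z \<Rightarrow> real"
  assumes z: "z \<in> Z" and F: "convex_on UNIV (\<lambda>x. F x z)" "continuous_on UNIV (\<lambda>x. F x z)"
    and neg: "F u z < 0"
    and polar: "\<And>a \<alpha>. (a, \<alpha>) \<in> normalized_epi u Z F \<Longrightarrow> \<alpha> - a \<bullet> x \<ge> 0"
  shows "F x z \<le> 0"
proof (rule ccontr)
  assume "\<not> F x z \<le> 0"
  then have "0 < F x z" by simp
  from convex_strict_affine_minorant[OF F this]
  obtain a \<alpha> where a: "\<And>x'. a \<bullet> x' - F x' z \<le> \<alpha>" "a \<bullet> x - \<alpha> > 0" by blast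
  \<comment> \<open>Dividing by \<open>L\<close> puts the minorant into the normalised set with
    multiplier \<open>t = 1 / L\<close>; the Slater inequality at \<open>u\<close> makes
    \<open>L\<close> positive.\<close>
  define L where "L = \<alpha> - a \<bullet> u"
  have L: "L > 0" using a(1)[of u] neg by (simp add: L_def)
  have "(1 / L) *\<^sub>R a \<bullet> x' - (1 / L) * F x' z \<le> \<alpha> / L" for x'
    using a(1)[of x'] L mult_left_mono[OF a(1)[of x'], of "1 / L"] by (simp add: right_diff_distrib)
  moreover have "\<alpha> / L - (1 / L) *\<^sub>R a \<bullet> u = 1"
    using L by (simp add: diff_divide_distrib[symmetric]) (simp add: L_def)
  ultimately have "((1 / L) *\<^sub>R a, \<alpha> / L) \<in> normalized_epi u Z F"
    unfolding normalized_epi_def using z L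
    by (auto intro!: bexI[of _ z] exI[of _ "1 / L"])
  from polar[OF this] show False
    using a(2) L by (simp add: field_simps)
qed

section \<open>Conic combinations in \<open>C1\<close> and \<open>C2\<close>, and the inequality on
  feasible points\<close>

lemma finite_sum_in_C1:
  fixes p :: "'a::euclidean_space \<Rightarrow> 'b::euclidean_space \<Rightarrow> real"
  assumes Y: "closed Y" and cont: "\<And>x. continuous_on UNIV (p x)"
    and S: "finite S" "S \<subseteq> normalized_epi u Y p" and w: "\<And>v. v \<in> S \<Longrightarrow> w v \<ge> 0"
  shows "(\<Sum>v\<in>S. w v *\<^sub>R v) \<in> C1 Y p"
proof -
  have "\<forall>v\<in>S. \<exists>z t. z \<in> Y \<and> t \<ge> 0 \<and> (\<forall>x. fst v \<bullet> x - t * p x z \<le> snd v)"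
    using S by (fastforce simp: normalized_epi_def)
  then obtain z t where zt: "\<And>v. v \<in> S \<Longrightarrow> z v \<in> Y" "\<And>v. v \<in> S \<Longrightarrow> t v \<ge> 0"
    "\<And>v x. v \<in> S \<Longrightarrow> fst v \<bullet> x - t v * p x (z v) \<le> snd v"
    by metis
  \<comment> \<open>The required measure has mass \<open>w v * t v\<close> at \<open>z v\<close>.
    Building it on \<open>S\<close> and pushing it forward along \<open>z\<close> adds up the masses
    when several \<open>v\<close> share the same point.\<close>
  define P where "P = point_measure S (\<lambda>v. ennreal (w v * t v))"
  define \<mu> where "\<mu> = distr P borel z"
  have zm: "z \<in> measurable P borel" by (simp add: P_def)
  have fP: "finite_measure P"
    using S by (intro finite_measureI) (simp add: P_def space_point_measure emeasure_point_measure_finite)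
  have YB: "Y \<in> sets borel" using Y by simp
  have vim: "z -` (UNIV - Y) \<inter> space P = {}"
    using zt(1) by (auto simp: P_def space_point_measure)
  have "emeasure \<mu> (UNIV - Y) = 0"
    unfolding \<mu>_def using YB by (subst emeasure_distr[OF zm]) (auto simp: vim)
  then have mu: "\<mu> \<in> finite_measures_on Y"
    using finite_measure.finite_measure_distr[OF fP zm]
    by (simp add: finite_measures_on_def \<mu>_def)
  have int: "(LINT y:Y|\<mu>. p x y) = (\<Sum>v\<in>S. w v * t v * p x (z v))" for x
  proof -
    have [measurable]: "p x \<in> borel_measurable borel"
      using cont by (rule borel_measurable_continuous_onI)
    have "(\<lambda>y. indicator Y y *\<^sub>R p x y) \<in> borel_measurable borel"
      using YB by measurable
    then have "(LINT y:Y|\<mu>. p x y) = (LINT v|P. indicator Y (z v) *\<^sub>R p x (z v))"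
      unfolding set_lebesgue_integral_def \<mu>_def by (rule integral_distr[OF zm])
    also have "\<dots> = (\<Sum>v\<in>S. (w v * t v) *\<^sub>R (indicator Y (z v) *\<^sub>R p x (z v)))"
      unfolding P_def
      by (rule lebesgue_integral_point_measure_finite) (use S w zt in auto)
    also have "\<dots> = (\<Sum>v\<in>S. w v * t v * p x (z v))"
      using zt by (intro sum.cong) auto
    finally show ?thesis .
  qed
  have "fst (\<Sum>v\<in>S. w v *\<^sub>R v) \<bullet> x - (LINT y:Y|\<mu>. p x y) \<le> snd (\<Sum>v\<in>S. w v *\<^sub>R v)" for x
  proof -
    have "fst (\<Sum>v\<in>S. w v *\<^sub>R v) \<bullet> x - (LINT y:Y|\<mu>. p x y)
        = (\<Sum>v\<in>S. w v * (fst v \<bullet> x - t v * p x (z v)))"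
      by (simp add: int fst_sum inner_sum_left sum_subtractf right_diff_distrib mult.assoc)
    also have "\<dots> \<le> (\<Sum>v\<in>S. w v * snd v)"
      using zt w by (intro sum_mono mult_left_mono) auto
    finally show ?thesis by (simp add: snd_sum)
  qed
  then have "(\<Sum>v\<in>S. w v *\<^sub>R v) \<in> epi (conjugate (\<lambda>x. LINT y:Y|\<mu>. p x y))"
    by (cases "\<Sum>v\<in>S. w v *\<^sub>R v") (simp add: epi_conjugate_iff)
  then show ?thesis using mu by (auto simp: C1_def)
qed

lemma C2_iff:
  "(a, \<alpha>) \<in> C2 s \<psi> \<longleftrightarrow>
    (\<exists>\<eta>. (\<forall>j\<in>{1..s}. 0 \<le> \<eta> j) \<and> (\<forall>x. a \<bullet> x - (\<Sum>j=1..s. \<eta> j * \<psi> j x) \<le> \<alpha>))"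
  by (auto simp: C2_def epi_conjugate_iff)

lemma zero_upward_in_C2: "r \<ge> 0 \<Longrightarrow> (0, r) \<in> C2 s \<psi>"
  unfolding C2_iff by (rule exI[of _ "\<lambda>_. 0"]) auto

lemma add_in_C2:
  assumes "v \<in> C2 s \<psi>" "v' \<in> C2 s \<psi>"
  shows "v + v' \<in> C2 s \<psi>"
proof -
  obtain a \<alpha> a' \<alpha>' where v: "v = (a, \<alpha>)" "v' = (a', \<alpha>')" by (metis prod.exhaust)
  obtain \<eta> \<eta>' where e: "\<forall>j\<in>{1..s}. 0 \<le> \<eta> j" "\<And>x. a \<bullet> x - (\<Sum>j=1..s. \<eta> j * \<psi> j x) \<le> \<alpha>"
    "\<forall>j\<in>{1..s}. 0 \<le> \<eta>' j" "\<And>x. a' \<bullet> x - (\<Sum>j=1..s. \<eta>' j * \<psi> j x) \<le> \<alpha>'"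
    using assms by (auto simp: v C2_iff)
  have "(a + a') \<bullet> x - (\<Sum>j=1..s. (\<eta> j + \<eta>' j) * \<psi> j x) \<le> \<alpha> + \<alpha>'" for x
    using e(2)[of x] e(4)[of x] by (simp add: inner_add_left distrib_right sum.distrib)
  then show ?thesis
    using e(1,3) by (auto simp: v C2_iff intro!: exI[of _ "\<lambda>j. \<eta> j + \<eta>' j"])
qed

lemma scaleR_in_C2:
  assumes "v \<in> C2 s \<psi>" "c \<ge> 0"
  shows "c *\<^sub>R v \<in> C2 s \<psi>"
proof -
  obtain a \<alpha> where v: "v = (a, \<alpha>)" by (metis prod.exhaust)
  obtain \<eta> where e: "\<forall>j\<in>{1..s}. 0 \<le> \<eta> j" "\<And>x. a \<bullet> x - (\<Sum>j=1..s. \<eta> j * \<psi> j x) \<le> \<alpha>"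
    using assms by (auto simp: v C2_iff)
  have "c *\<^sub>R a \<bullet> x - (\<Sum>j=1..s. (c * \<eta> j) * \<psi> j x) \<le> c * \<alpha>" for x
    using mult_left_mono[OF e(2)[of x] assms(2)]
    by (simp add: right_diff_distrib sum_distrib_left mult.assoc)
  then show ?thesis
    using e(1) assms(2) by (auto simp: v C2_iff intro!: exI[of _ "\<lambda>j. c * \<eta> j"])
qed

lemma sum_in_C2:
  assumes "\<And>v. v \<in> S \<Longrightarrow> v \<in> C2 s \<psi>" "\<And>v. v \<in> S \<Longrightarrow> w v \<ge> 0"
  shows "(\<Sum>v\<in>S. w v *\<^sub>R v) \<in> C2 s \<psi>"
  using assms
proof (induction S rule: infinite_finite_induct)
  case (insert v S)
  then have "w v *\<^sub>R v + (\<Sum>v\<in>S. w v *\<^sub>R v) \<in> C2 s \<psi>"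
    by (intro add_in_C2 scaleR_in_C2) blast+
  then show ?case using insert.hyps by simp
\<comment> \<open>A sum over an infinite \<open>S\<close> is 0 by convention, so this case and the
  empty one both reduce to the origin.\<close>
qed (use zero_upward_in_C2[of 0] in \<open>auto simp: zero_prod_def\<close>)

lemma normalized_epi_subset_C2:
  "normalized_epi u {1..s} (\<lambda>x j. \<psi> j x) \<subseteq> C2 s \<psi>"
proof (clarsimp simp: normalized_epi_def)
  fix a \<alpha> j and t :: real
  assume h: "Suc 0 \<le> j" "j \<le> s" "0 \<le> t" "\<forall>x. a \<bullet> x - t * \<psi> j x \<le> \<alpha>"
  have "(\<Sum>i=1..s. (if i = j then t else 0) * \<psi> i x) = t * \<psi> j x" for x
    using h by (simp add: if_distrib[of "\<lambda>c. c * _"] sum.delta cong: if_cong)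
  then show "(a, \<alpha>) \<in> C2 s \<psi>"
    unfolding C2_iff using h by (intro exI[of _ "\<lambda>i. if i = j then t else 0"]) auto
qed

text \<open>This is weak duality: at a feasible point the integral and the weighted sum are both
  nonpositive, so dropping them preserves the upper bounds.\<close>

lemma polar_if_in_C1_plus_C2:
  fixes p :: "'a::euclidean_space \<Rightarrow> 'b::euclidean_space \<Rightarrow> real"
  assumes mem: "(\<xi>, r) \<in> C1 Y p + C2 s \<psi>"
    and x: "\<And>j. j \<in> {1..s} \<Longrightarrow> \<psi> j x \<le> 0" "\<And>y. y \<in> Y \<Longrightarrow> p x y \<le> 0"
  shows "\<xi> \<bullet> x \<le> r"
proof -
  obtain a \<alpha> b \<beta> where ab: "(a, \<alpha>) \<in> C1 Y p" "(b, \<beta>) \<in> C2 s \<psi>" "\<xi> = a + b" "r = \<alpha> + \<beta>"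
    using mem by (auto simp: set_plus_def)
  obtain \<mu> where "a \<bullet> x - (LINT y:Y|\<mu>. p x y) \<le> \<alpha>"
    using ab(1) by (auto simp: C1_def epi_conjugate_iff)
  \<comment> \<open>A non-integrable integrand has integral 0 by convention, so the sign argument
    covers that case too.\<close>
  moreover have "(LINT y:Y|\<mu>. - p x y) \<ge> 0"
    unfolding set_lebesgue_integral_def
    by (rule integral_nonneg_AE) (use x in \<open>auto simp: indicator_def\<close>)
  then have "(LINT y:Y|\<mu>. p x y) \<le> 0"
    by (simp add: set_lebesgue_integral_def)
  moreover obtain \<eta> where e: "\<forall>j\<in>{1..s}. 0 \<le> \<eta> j" "b \<bullet> x - (\<Sum>j=1..s. \<eta> j * \<psi> j x) \<le> \<beta>"
    using ab(2) by (auto simp: C2_iff)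
  moreover have "(\<Sum>j=1..s. \<eta> j * \<psi> j x) \<le> 0"
    using e(1) x(1) by (intro sum_nonpos mult_nonneg_nonpos) auto
  ultimately show ?thesis using ab by (simp add: inner_add_left)
qed

section \<open>The Farkas inclusion and closedness, via \<open>W \<subseteq> C1 Y p + C2 s \<psi>
  \<subseteq> Q \<subseteq> W\<close>\<close>

theorem propositionA2:
  fixes Y :: "(real ^ 'n) set"
    and p :: "real ^ 'm \<Rightarrow> real ^ 'n \<Rightarrow> real"
    and s :: nat
    and \<psi> :: "nat \<Rightarrow> real ^ 'm \<Rightarrow> real"
  assumes "compact Y"
    and "\<And>j. j \<in> {1..s} \<Longrightarrow> continuous_on UNIV (\<psi> j) \<and> convex_on UNIV (\<psi> j)"
    and "\<And>y. y \<in> Y \<Longrightarrow>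
           continuous_on UNIV (\<lambda>x. p x y) \<and> convex_on UNIV (\<lambda>x. p x y)"
    and "lower_semicont (\<lambda>(x, y). p x y)"
    and "\<And>x. continuous_on UNIV (\<lambda>y. p x y)"
    and "{x. (\<forall>j\<in>{1..s}. \<psi> j x \<le> 0) \<and> (\<forall>y\<in>Y. p x y \<le> 0)} \<noteq> {}"
    and "\<exists>u. (\<forall>y\<in>Y. p u y < 0) \<and> (\<forall>j\<in>{1..s}. \<psi> j u < 0)"
  shows "closed (C1 Y p + C2 s \<psi>)"
proof -
  obtain u where uY: "\<And>y. y \<in> Y \<Longrightarrow> p u y < 0" and uj: "\<And>j. j \<in> {1..s} \<Longrightarrow> \<psi> j u < 0"
    using assms(7) by blast
  define K where "K = {x. (\<forall>j\<in>{1..s}. \<psi> j x \<le> 0) \<and> (\<forall>y\<in>Y. p x y \<le> 0)}"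
  define Q where "Q = (\<Inter>x\<in>K. {w. fst w \<bullet> x \<le> snd w})"
  define BY where "BY = normalized_epi u Y p"
  \<comment> \<open>The generator \<open>(0, 1)\<close> keeps \<open>W\<close> nonempty and later
    forces the last coordinate of a separating normal to be nonnegative.\<close>
  define BJ where "BJ = insert (0, 1) (normalized_epi u {1..s} (\<lambda>x j. \<psi> j x))"
  define W where "W = conic hull (convex hull (BY \<union> BJ))"
  have "closed Q"
    unfolding Q_def by (intro closed_INT ballI closed_Collect_le continuous_intros)
  have cp: "continuous_on A (p x)" for x A
    using assms(5)[of x] by (rule continuous_on_subset) simp
  have "compact BY"
    unfolding BY_def by (rule compact_normalized_epi[where F = p, OF assms(1) cp uY])
  moreover have "continuous_on {1..s} (\<lambda>j. \<psi> j x)" for x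
    unfolding continuous_on_topological by (metis insertI1 open_discrete singletonD)
  from compact_normalized_epi[where F = "\<lambda>x j. \<psi> j x", OF finite_imp_compact[OF finite_atLeastAtMost] this uj]
  have "compact (normalized_epi u {1..s} (\<lambda>x j. \<psi> j x))" .
  ultimately have cB: "compact (BY \<union> BJ)"
    unfolding BJ_def by (intro compact_Un compact_insert)
  \<comment> \<open>The hull lies in a hyperplane missing the origin, which is what closedness of
    its conic hull requires.\<close>
  have L: "snd w - fst w \<bullet> u = 1" if "w \<in> convex hull (BY \<union> BJ)" for w
  proof -
    have "convex {w :: (real ^ 'm) \<times> real. (- u, 1) \<bullet> w = 1}" by (rule convex_hyperplane)
    moreover have "BY \<union> BJ \<subseteq> {w. (- u, 1) \<bullet> w = 1}"
      by (auto simp: BY_def BJ_def normalized_epi_def inner_commute)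
    ultimately have "convex hull (BY \<union> BJ) \<subseteq> {w. (- u, 1) \<bullet> w = 1}" by (rule hull_minimal[rotated])
    then show ?thesis using that by (auto simp: inner_commute inner_prod_def)
  qed
  have "closed W"
    unfolding W_def using cB L[of 0] by (intro closed_conic_hull) (auto intro: compact_convex_hull)
  have "convex W"
    unfolding W_def by (intro convex_conic_hull convex_convex_hull)
  have W_scale: "c *\<^sub>R w \<in> W" if "w \<in> BY \<union> BJ" "c \<ge> 0" for c w
    using that unfolding W_def conic_hull_explicit by (blast intro: hull_inc)
  have "W \<subseteq> C1 Y p + C2 s \<psi>"
  proof
    fix w assume "w \<in> W"
    then obtain c b where c: "c \<ge> 0" and b: "b \<in> convex hull (BY \<union> BJ)" and w: "w = c *\<^sub>R b"
      unfolding W_def conic_hull_explicit by blast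
    from b obtain S k where S: "finite S" "S \<subseteq> BY \<union> BJ" and k: "\<And>v. v \<in> S \<Longrightarrow> k v \<ge> 0"
      and b_eq: "(\<Sum>v\<in>S. k v *\<^sub>R v) = b"
      unfolding convex_hull_explicit by blast
    have "w = (\<Sum>v\<in>S. (c * k v) *\<^sub>R v)" by (simp add: w b_eq[symmetric] scaleR_sum_right)
    \<comment> \<open>Generators in both sets are assigned to the \<open>C1\<close> part, so that
      each is counted once.\<close>
    also have "\<dots> = (\<Sum>v\<in>S \<inter> BY. (c * k v) *\<^sub>R v) + (\<Sum>v\<in>S - BY. (c * k v) *\<^sub>R v)"
      using S(1) by (rule sum.Int_Diff)
    also have "\<dots> \<in> C1 Y p + C2 s \<psi>"
    proof (rule set_plus_intro)
      show "(\<Sum>v\<in>S \<inter> BY. (c * k v) *\<^sub>R v) \<in> C1 Y p"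
        using assms(1) cp S k c
        by (intro finite_sum_in_C1[where u = u]) (auto simp: BY_def compact_imp_closed)
      have "BJ \<subseteq> C2 s \<psi>"
        using normalized_epi_subset_C2 zero_upward_in_C2[of 1] by (auto simp: BJ_def)
      then show "(\<Sum>v\<in>S - BY. (c * k v) *\<^sub>R v) \<in> C2 s \<psi>"
        using S(2) k c by (intro sum_in_C2) auto
    qed
    finally show "w \<in> C1 Y p + C2 s \<psi>" .
  qed
  moreover have "C1 Y p + C2 s \<psi> \<subseteq> Q"
    using polar_if_in_C1_plus_C2 by (fastforce simp: Q_def K_def)
  moreover have "Q \<subseteq> W"
  proof (rule subsetI, rule ccontr)
    fix q assume q: "q \<in> Q" "q \<notin> W"
    obtain \<xi> r where qr: "q = (\<xi>, r)" by (cases q)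
    obtain f \<beta> where f: "f \<bullet> q < \<beta>" "\<And>w. w \<in> W \<Longrightarrow> f \<bullet> w > \<beta>"
      using separating_hyperplane_closed_point[OF \<open>convex W\<close> \<open>closed W\<close> q(2)] by metis
    have e1: "(0, 1) \<in> BY \<union> BJ" by (simp add: BJ_def)
    have b0: "\<beta> < 0" using f(2)[OF W_scale[OF e1, of 0]] by (simp add: zero_prod_def[symmetric])
    have f0: "f \<bullet> w \<ge> 0" if "w \<in> BY \<union> BJ" for w
    proof (rule ccontr)
      assume n: "\<not> f \<bullet> w \<ge> 0"
      \<comment> \<open>Scaling \<open>w\<close> by this factor gives a point of \<open>W\<close>
        where \<open>f\<close> equals \<beta>, against the strict separation.\<close>
      then have "\<beta> / (f \<bullet> w) \<ge> 0" using b0 by (simp add: divide_nonpos_nonpos)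
      from f(2)[OF W_scale[OF that this]] show False using n by simp
    qed
    obtain v c where vc: "f = (v, c)" by (cases f)
    have c0: "c \<ge> 0" using f0[OF e1] by (simp add: vc)
    have fq: "v \<bullet> \<xi> + c * r < 0" using f(1) b0 by (simp add: vc qr)
    text \<open>Tilting by the Slater functional makes the separating hyperplane non-vertical.\<close>
    define D where "D = \<bar>r - u \<bullet> \<xi>\<bar> + 1"
    \<comment> \<open>Since \<open>D\<close> exceeds
      \<open>\<bar>r - u \<bullet> \<xi>\<bar>\<close>, the tilt uses up at most half of the
      negative value at \<open>q\<close>.\<close>
    define \<epsilon> where "\<epsilon> = - (v \<bullet> \<xi> + c * r) / (2 * D)"
    have D: "D > 0" by (simp add: D_def add_nonneg_pos)
    have eps: "\<epsilon> > 0" using fq D unfolding \<epsilon>_def by (intro divide_pos_pos) auto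
    have "\<epsilon> * (r - u \<bullet> \<xi>) \<le> \<epsilon> * D" using eps by (intro mult_left_mono) (auto simp: D_def)
    also have "\<epsilon> * D = - (v \<bullet> \<xi> + c * r) / 2" using D by (simp add: \<epsilon>_def)
    finally have tilt: "(v \<bullet> \<xi> + c * r) + \<epsilon> * (r - u \<bullet> \<xi>) < 0" using fq by simp
    \<comment> \<open>The tilted normal is
      \<open>(v - \<epsilon> *\<^sub>R u, c + \<epsilon>)\<close>; dividing by its last coordinate
      gives \<open>(- x, 1)\<close>.\<close>
    define x where "x = (1 / (c + \<epsilon>)) *\<^sub>R (\<epsilon> *\<^sub>R u - v)"
    have ce: "c + \<epsilon> > 0" using c0 eps by simp
    have val: "(c + \<epsilon>) * (\<alpha> - a \<bullet> x) = (v \<bullet> a + c * \<alpha>) + \<epsilon> * (\<alpha> - a \<bullet> u)" for a \<alpha>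
    proof -
      have "(c + \<epsilon>) * (a \<bullet> x) = \<epsilon> * (a \<bullet> u) - a \<bullet> v"
        using ce by (simp add: x_def inner_diff_right)
      then show ?thesis by (simp add: algebra_simps inner_commute)
    qed
    have polar: "\<alpha> - a \<bullet> x \<ge> 0" if "(a, \<alpha>) \<in> BY \<union> BJ" for a \<alpha>
    proof -
      have "v \<bullet> a + c * \<alpha> \<ge> 0" using f0[OF that] by (simp add: vc)
      moreover have "\<alpha> - a \<bullet> u = 1" using L[OF hull_inc[OF that]] by simp
      ultimately have "(c + \<epsilon>) * (\<alpha> - a \<bullet> x) \<ge> 0" unfolding val using eps by simp
      then show ?thesis using ce by (simp add: zero_le_mult_iff)
    qed
    have "p x y \<le> 0" if "y \<in> Y" for y
      using that assms(3)[OF that] uY[OF that] polar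
      by (intro nonpos_if_polar_normalized_epi[where F = p and Z = Y and u = u]) (auto simp: BY_def)
    moreover have "\<psi> j x \<le> 0" if "j \<in> {1..s}" for j
      using that assms(2)[OF that] uj[OF that] polar
      by (intro nonpos_if_polar_normalized_epi[where F = "\<lambda>x j. \<psi> j x" and Z = "{1..s}" and u = u])
         (auto simp: BJ_def)
    ultimately have "x \<in> K" by (auto simp: K_def)
    then have "r - \<xi> \<bullet> x \<ge> 0" using q(1) by (auto simp: Q_def qr)
    then have "(c + \<epsilon>) * (r - \<xi> \<bullet> x) \<ge> 0" using ce by (intro mult_nonneg_nonneg) auto
    then show False using tilt by (simp add: val inner_commute)
  qed
  ultimately have "C1 Y p + C2 s \<psi> = Q" by blast
  then show ?thesis using \<open>closed Q\<close> by simp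
qed

end
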